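(* Let $d$ be a positive integer and let $g:(0,\infty)\to(0,\infty)$ be a function of polynomial growth. If there is a Danzer set $D\subseteq\mathbb{R}^d$ of growth rate $g(T)$, then there exists a Danzer set contained in $\mathbb{Q}^d$ of growth rate $g(T)$.
   Context: A set $Y\subseteq\mathbb{R}^d$ is a Danzer set if it intersects every convex subset of $\mathbb{R}^d$ of volume $1$. $Y$ has growth (rate) $g(T)$ if $\#(Y\cap B(0,T))=O(g(T))$ as $T\to\infty$, where $B(0,T)$ is the Euclidean ball of radius $T$ about the origin. A function $g$ has polynomial growth if for every constant $C>0$ one has $g(Cx)=O(g(x))$ as $x\to\infty$. *)

theory Defs
  imports "HOL-Analysis.Analysis" "HOL-Library.Landau_Symbols"
begin

text \<open>
  Convex sets need not be Borel, but they are always Lebesgue measurable; hence the volume is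
  taken with respect to \<^const>\<open>lebesgue\<close>.
\<close>

definition danzer_set :: "(real ^ 'n) set \<Rightarrow> bool" where
  "danzer_set Y \<longleftrightarrow> (\<forall>K. convex K \<and> emeasure lebesgue K = 1 \<longrightarrow> Y \<inter> K \<noteq> {})"

text \<open>
  Finiteness is part of the meaning of the bound, and has to be required explicitly because
  \<^const>\<open>card\<close> of an infinite set is 0.
\<close>

definition has_growth :: "(real ^ 'n) set \<Rightarrow> (real \<Rightarrow> real) \<Rightarrow> bool" where
  "has_growth Y g \<longleftrightarrow>
     (\<forall>T. finite (Y \<inter> ball 0 T)) \<and> (\<lambda>T. real (card (Y \<inter> ball 0 T))) \<in> O[at_top](g)"

definition polynomial_growth :: "(real \<Rightarrow> real) \<Rightarrow> bool" where
  "polynomial_growth g \<longleftrightarrow> (\<forall>C>0. (\<lambda>x. g (C * x)) \<in> O[at_top](g))"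

definition rational_points :: "(real ^ 'n) set" where
  "rational_points = {x. \<forall>i. x $ i \<in> \<rat>}"

end

theory Submission
  imports Defs
begin

text \<open>
  Replace each point \<open>y \<in> D\<close> by a rational point within \<open>\<epsilon> y\<close> of \<open>y / 16\<close>, where \<open>\<epsilon>\<close> decays
  rapidly at infinity. A very thin convex set passing near the origin might be missed by the
  perturbed points there, so only points far out are used: if \<open>K\<close> has volume 1, \<open>p \<in> K\<close> is
  of almost maximal norm, and \<open>c\<close> is the centre of a ball inside \<open>K\<close>, then
  \<open>\<lambda> K + (7/8 - \<lambda>) p + c / 8\<close> with a suitable \<open>\<lambda> \<le> 1/8\<close> is a copy of \<open>K\<close> of fixed volume,
  it keeps a distance from the complement of \<open>K\<close>, and its points have norm comparable to the
  maximal norm in \<open>K\<close>. That norm bounds the inradius of \<open>K\<close> from below: the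
  centroid lies deep inside \<open>K\<close>, since otherwise, by Markov's inequality, half of \<open>K\<close> would lie in
  a thin slab.
\<close>

section \<open>Thin slabs, centroids and inradius\<close>

text \<open>The \<open>N\<close> translates of \<open>S\<close> by multiples of \<open>2 * t\<close>
  along \<open>u\<close> lie in disjoint open slabs. All shifts have length at most 1, so everything
  stays in the ball of radius \<open>R + 1\<close>, whose volume therefore bounds \<open>N\<close>
  times that of \<open>S\<close>.\<close>

lemma measure_slab_le:
  fixes u :: "'a::euclidean_space"
  assumes u: "norm u = 1" and t: "t > 0" "real N * (2 * t) \<le> 1"
    and S: "S \<in> lmeasurable" "S \<subseteq> cball 0 R" "\<And>x. x \<in> S \<Longrightarrow> \<bar>u \<bullet> x - b\<bar> < t"
  shows "real N * measure lebesgue S \<le> measure lebesgue (cball (0::'a) (R + 1))"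
proof -
  define F where "F k = (+) ((2 * t * real k) *\<^sub>R u) ` S" for k
  have F: "F k \<in> lmeasurable" "measure lebesgue (F k) = measure lebesgue S" for k
    using S(1) by (auto simp: F_def measurable_translation measure_translation)
  have uu: "u \<bullet> u = 1" using u by (simp add: norm_eq_1)
  have slab: "\<bar>u \<bullet> y - b - 2 * t * real k\<bar> < t" if "y \<in> F k" for y k
    using that S(3) by (auto simp: F_def inner_add_right uu)
  have disj: "disjoint_family_on F {..<N}"
  unfolding disjoint_family_on_def
  proof (intro ballI impI, rule ccontr)
    fix k l assume "k \<noteq> l" "F k \<inter> F l \<noteq> {}"
    then obtain y where "y \<in> F k" "y \<in> F l" by auto
    then have "\<bar>2 * t * real k - 2 * t * real l\<bar> < 2 * t"
      using slab[of y k] slab[of y l] by linarith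
    then have "2 * t * \<bar>real k - real l\<bar> < 2 * t * 1"
      using t by (simp add: abs_mult flip: right_diff_distrib)
    then have "\<bar>real k - real l\<bar> < 1" using t by (simp only: mult_less_cancel_left_pos)
    with \<open>k \<noteq> l\<close> show False by linarith
  qed
  have "(\<Union>k<N. F k) \<subseteq> cball 0 (R + 1)"
  proof
    fix y assume "y \<in> (\<Union>k<N. F k)"
    then obtain k x where k: "k < N" "x \<in> S" and y: "y = (2 * t * real k) *\<^sub>R u + x"
      by (auto simp: F_def)
    have "2 * t * real k \<le> 2 * t * real N" using k t by simp
    also have "\<dots> \<le> 1" using t by (simp add: mult_ac)
    finally have "norm ((2 * t * real k) *\<^sub>R u) \<le> 1" using u t by simp
    moreover have "norm x \<le> R" using S(2) k by auto
    ultimately have "norm y \<le> R + 1" unfolding y by (intro norm_triangle_le) linarith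
    then show "y \<in> cball 0 (R + 1)" by simp
  qed
  then have "measure lebesgue (\<Union>k<N. F k) \<le> measure lebesgue (cball (0::'a) (R + 1))"
    by (intro measure_mono_fmeasurable) (use F in \<open>auto intro: fmeasurableD\<close>)
  moreover have "measure lebesgue (\<Union>k<N. F k) = (\<Sum>k<N. measure lebesgue (F k))"
    using F disj by (intro measure_finite_Union) (auto simp: fmeasurableD fmeasurableD2 simp del: emeasure_completion)
  ultimately show ?thesis by (simp add: F)
qed

text \<open>The function \<open>u \<bullet> (x - c)\<close> has mean zero over \<open>K\<close>
  because \<open>c\<close> is the centroid. Being at most \<open>r\<close>, its absolute value is at
  most \<open>2 * r\<close> minus itself, so has mean at most \<open>2 * r\<close>. By Markov's
  inequality it reaches \<open>4 * r\<close> on at most half of \<open>K\<close>.\<close>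

lemma centroid_deep:
  fixes K :: "'a::euclidean_space set"
  assumes K: "K \<in> lmeasurable" "bounded K" and v: "measure lebesgue K > 0" and r: "r > 0"
    and c: "c = (1 / measure lebesgue K) *\<^sub>R integral\<^sup>L (lebesgue_on K) (\<lambda>x. x)"
    and u: "\<And>x. x \<in> K \<Longrightarrow> u \<bullet> (x - c) \<le> r"
  shows "measure lebesgue K \<le> 2 * measure lebesgue {x \<in> K. \<bar>u \<bullet> x - u \<bullet> c\<bar> < 4 * r}"
proof -
  let ?M = "lebesgue_on K" and ?v = "measure lebesgue K"
  interpret finite_measure ?M using K(1) by (rule finite_measure_lebesgue_on)
  have Ks: "K \<in> sets lebesgue" using K(1) by (rule fmeasurableD)
  have sp: "space ?M = K" by simp
  have id_meas: "(\<lambda>x. x) \<in> borel_measurable ?M"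
    by (rule measurable_restrict_space1) (simp add: measurable_completion)
  obtain B where B: "\<And>x. x \<in> K \<Longrightarrow> norm x \<le> B" using K(2) by (auto simp: bounded_iff)
  have int_id: "integrable ?M (\<lambda>x. x)"
    by (rule integrable_const_bound[of _ B]) (use B id_meas in auto)
  have mv: "measure ?M K = ?v" using Ks by (simp add: measure_restrict_space)
  define s where "s x = u \<bullet> x - u \<bullet> c" for x
  have int_u: "integrable ?M (\<lambda>x. u \<bullet> x)" using int_id by simp
  have int_s: "integrable ?M s" unfolding s_def using int_u by simp
  have "integral\<^sup>L ?M s = u \<bullet> integral\<^sup>L ?M (\<lambda>x. x) - (u \<bullet> c) * ?v"
    unfolding s_def using int_id int_u mv by (simp add: mult.commute)
  also have "\<dots> = 0" using v by (simp add: c)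
  finally have s0: "integral\<^sup>L ?M s = 0" .
  have "integral\<^sup>L ?M (\<lambda>x. \<bar>s x\<bar>) \<le> integral\<^sup>L ?M (\<lambda>x. 2 * r - s x)"
  proof (rule integral_mono)
    fix x assume "x \<in> space ?M"
    then have "s x \<le> r" using u by (simp add: s_def inner_diff_right)
    then show "\<bar>s x\<bar> \<le> 2 * r - s x" using r by linarith
  qed (use int_s in simp_all)
  also have "\<dots> = 2 * r * ?v" using int_s s0 mv by simp
  finally have "integral\<^sup>L ?M (\<lambda>x. \<bar>s x\<bar>) \<le> 2 * r * ?v" .
  moreover have "measure ?M {x \<in> space ?M. \<bar>s x\<bar> \<ge> 4 * r} \<le> integral\<^sup>L ?M (\<lambda>x. \<bar>s x\<bar>) / (4 * r)"
    by (rule integral_Markov_inequality_measure[of _ _ "{}"]) (use int_s r in auto)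
  ultimately have "measure ?M {x \<in> space ?M. \<bar>s x\<bar> \<ge> 4 * r} \<le> 2 * r * ?v / (4 * r)"
    using r by (meson divide_right_mono less_imp_le mult_pos_pos order_trans zero_less_numeral)
  then have far: "measure ?M {x \<in> space ?M. \<bar>s x\<bar> \<ge> 4 * r} \<le> ?v / 2"
    using r by simp
  have [measurable]: "s \<in> borel_measurable ?M" using int_s by simp
  have "{x \<in> space ?M. \<bar>s x\<bar> \<ge> 4 * r} \<in> sets ?M" "{x \<in> space ?M. \<bar>s x\<bar> < 4 * r} \<in> sets ?M"
    by measurable
  then have "measure ?M (space ?M) =
      measure ?M {x \<in> space ?M. \<bar>s x\<bar> \<ge> 4 * r} + measure ?M {x \<in> space ?M. \<bar>s x\<bar> < 4 * r}"
    by (subst finite_measure_Union[symmetric]) (auto intro!: arg_cong[where f = "measure ?M"])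
  moreover have "measure ?M {x \<in> space ?M. \<bar>s x\<bar> < 4 * r} = measure lebesgue {x \<in> K. \<bar>s x\<bar> < 4 * r}"
    using Ks by (simp add: measure_restrict_space)
  ultimately show ?thesis using far mv unfolding sp s_def by linarith
qed

text \<open>The centre is the centroid, which does not depend on \<open>R\<close>. This order of
  quantifiers lets a later argument fix \<open>c\<close> first and choose \<open>R\<close> from a
  point whose construction involves \<open>c\<close>.\<close>

lemma convex_contains_ball:
  obtains \<rho> :: "real \<Rightarrow> real" where "\<And>R. \<rho> R > 0"
    and "\<And>K :: 'a::euclidean_space set. \<lbrakk>convex K; bounded K; measure lebesgue K \<ge> 1 / 2\<rbrakk> \<Longrightarrow>
      \<exists>c. \<forall>R. K \<subseteq> cball 0 R \<longrightarrow> ball c (\<rho> R) \<subseteq> K"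
proof -
  \<comment> \<open>The constants fit a slab of half-width \<open>4 * \<rho> R\<close>:
    \<open>N R\<close> disjoint translates have total shift at most 1. If the slab held volume 1/4,
    they would fill more than the ball of radius \<open>R + 1\<close>; adding 1 makes this
    strict.\<close>
  define N where "N R = nat \<lceil>4 * measure lebesgue (cball (0::'a) (R + 1))\<rceil> + 1" for R
  define \<rho> where "\<rho> R = 1 / (8 * real (N R))" for R
  have N: "real (N R) > 4 * measure lebesgue (cball (0::'a) (R + 1))" "real (N R) > 0" for R
    unfolding N_def using measure_nonneg[of lebesgue "cball (0::'a) (R + 1)"] by linarith+
  have pos: "\<rho> R > 0" for R using N(2)[of R] by (simp add: \<rho>_def)
  moreover have "\<exists>c. \<forall>R. K \<subseteq> cball 0 R \<longrightarrow> ball c (\<rho> R) \<subseteq> K"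
    if K: "convex K" "bounded K" "measure lebesgue K \<ge> 1 / 2" for K :: "'a set"
  proof -
    have Km: "K \<in> lmeasurable" using K by (simp add: measurable_convex)
    define c where "c = (1 / measure lebesgue K) *\<^sub>R integral\<^sup>L (lebesgue_on K) (\<lambda>x. x)"
    have "z \<in> K" if R: "K \<subseteq> cball 0 R" and z: "z \<in> ball c (\<rho> R)" for R z
    proof (rule ccontr)
      assume "z \<notin> K"
      \<comment> \<open>A hyperplane separates the missing point \<open>z\<close> from
        \<open>K\<close>. As \<open>z\<close> is within \<open>\<rho> R\<close> of \<open>c\<close>,
        \<open>K\<close> extends at most \<open>\<rho> R\<close> beyond the centroid in the normal
        direction.\<close>
      have "K \<noteq> {}" using K(3) by auto
      with \<open>z \<notin> K\<close> K(1) obtain a b where a: "a \<noteq> 0" "\<And>x. x \<in> K \<Longrightarrow> a \<bullet> x \<le> b" "b \<le> a \<bullet> z"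
        using separating_hyperplane_sets[of K "{z}"] by auto
      define u where "u = a /\<^sub>R norm a"
      have u: "norm u = 1" using a(1) by (simp add: u_def)
      have ux: "u \<bullet> (x - c) \<le> \<rho> R" if "x \<in> K" for x
      proof -
        have "a \<bullet> x \<le> a \<bullet> z" using a that by fastforce
        then have "u \<bullet> x \<le> u \<bullet> z" by (simp add: u_def mult_left_mono)
        moreover have "u \<bullet> (z - c) \<le> norm u * norm (z - c)" by (rule norm_cauchy_schwarz)
        moreover have "norm (z - c) < \<rho> R" using z by (simp add: dist_norm norm_minus_commute)
        ultimately show ?thesis using u by (simp add: inner_diff_right)
      qed
      let ?S = "{x \<in> K. \<bar>u \<bullet> x - u \<bullet> c\<bar> < 4 * \<rho> R}"
      have "1 / 2 \<le> 2 * measure lebesgue ?S"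
        using centroid_deep[OF Km K(2) _ pos c_def ux] K(3) by linarith
      moreover have "real (N R) * measure lebesgue ?S \<le> measure lebesgue (cball (0::'a) (R + 1))"
      proof (rule measure_slab_le[OF u, where t = "4 * \<rho> R" and b = "u \<bullet> c"])
        have "?S = K \<inter> {x. u \<bullet> x < u \<bullet> c + 4 * \<rho> R} \<inter> {x. u \<bullet> x > u \<bullet> c - 4 * \<rho> R}"
          by (auto simp: abs_less_iff)
        then have "convex ?S"
          by (simp add: K(1) convex_Int convex_halfspace_lt convex_halfspace_gt)
        moreover have "bounded ?S" using K(2) by (rule bounded_subset) auto
        ultimately show "?S \<in> lmeasurable" by (rule measurable_convex)
      qed (use pos N(2)[of R] R in \<open>auto simp: \<rho>_def\<close>)
      moreover have "real (N R) * (1 / 4) \<le> real (N R) * measure lebesgue ?S"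
        using calculation(1) by (intro mult_left_mono) auto
      ultimately show False using N(1)[of R] by linarith
    qed
    then show ?thesis by blast
  qed
  ultimately show thesis by (rule that)
qed

section \<open>Perturbing a Danzer set\<close>

text \<open>\<open>K\<close> need not be closed, so the supremum of the norm may not be attained;
  the factor 2 leaves room for this.\<close>

lemma exists_almost_max_norm:
  fixes K :: "'a::real_normed_vector set"
  assumes "bounded K" "K \<noteq> {}"
  obtains p where "p \<in> K" "\<And>x. x \<in> K \<Longrightarrow> norm x \<le> 2 * norm p"
proof (cases "\<exists>x\<in>K. x \<noteq> 0")
  case True
  let ?s = "Sup (norm ` K)"
  have bdd: "bdd_above (norm ` K)"
    using assms(1) by (auto simp: bounded_iff bdd_above_def)
  then have le: "norm x \<le> ?s" if "x \<in> K" for x using that by (auto intro: cSup_upper)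
  have "?s > 0" using True le by (metis less_le_trans zero_less_norm_iff)
  then have "?s / 2 < ?s" by simp
  then obtain p where "p \<in> K" "?s / 2 < norm p"
    using assms(2) less_cSupE[of "?s / 2" "norm ` K"] by auto
  with le that show thesis by (smt (verit) field_sum_of_halves)
next
  case False
  then show thesis using assms(2) that by fastforce
qed

text \<open>A convex set of volume 1 may be unbounded. Its intersections with growing balls have
  volumes tending to 1.\<close>

lemma bounded_part_of_half_volume:
  fixes K :: "'a::euclidean_space set"
  assumes "convex K" "emeasure lebesgue K = 1"
  obtains L where "L \<subseteq> K" "convex L" "bounded L"
    "measure lebesgue L \<ge> 1 / 2" "measure lebesgue L \<le> 1"
proof -
  \<comment> \<open>\<open>emeasure\<close> is 0 on non-measurable sets, so the value 1 forces
    measurability.\<close>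
  have Ks: "K \<in> sets lebesgue" using assms(2) emeasure_notin_sets by fastforce
  let ?A = "\<lambda>n. K \<inter> cball 0 (real n)"
  have "(\<Union>n. ?A n) = K" by (auto simp: real_arch_simple)
  moreover have "(\<lambda>n. measure lebesgue (?A n)) \<longlonglongrightarrow> measure lebesgue (\<Union>n. ?A n)"
    by (rule Lim_measure_incseq) (use Ks calculation assms(2) in \<open>auto simp: incseq_def\<close>)
  ultimately have "(\<lambda>n. measure lebesgue (?A n)) \<longlonglongrightarrow> 1"
    using assms(2) by (simp add: measure_def)
  then have "\<forall>\<^sub>F n in sequentially. measure lebesgue (?A n) > 1 / 2"
    by (rule order_tendstoD) simp
  then obtain n where n: "measure lebesgue (?A n) > 1 / 2" by (auto simp: eventually_sequentially)
  have "measure lebesgue (?A n) \<le> measure lebesgue K"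
    using Ks assms(2) by (intro measure_mono_fmeasurable) (auto simp: fmeasurable_def)
  then show thesis
    using n assms by (intro that[of "?A n"]) (auto simp: convex_Int measure_def)
qed

lemma danzer_set_perturb:
  obtains \<epsilon> :: "real ^ 'n \<Rightarrow> real" where "\<And>y. \<epsilon> y > 0"
    and "\<And>D q. \<lbrakk>danzer_set D; \<And>y. y \<in> D \<Longrightarrow> norm (q y - y /\<^sub>R 16) < \<epsilon> y\<rbrakk> \<Longrightarrow> danzer_set (q ` D)"
proof -
  obtain \<rho> :: "real \<Rightarrow> real" where \<rho>: "\<And>R. \<rho> R > 0"
    and ball: "\<And>K :: (real ^ 'n) set. \<lbrakk>convex K; bounded K; measure lebesgue K \<ge> 1 / 2\<rbrakk> \<Longrightarrow>
      \<exists>c. \<forall>R. K \<subseteq> cball 0 R \<longrightarrow> ball c (\<rho> R) \<subseteq> K"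
    using convex_contains_ball[where 'a = "real ^ 'n"] by blast
  \<comment> \<open>The radius \<open>norm y / 2\<close> will be shown to contain the relevant
    convex set, and the factor 1/8 is the weight of \<open>c\<close> in the convex combination
    below.\<close>
  define \<epsilon> :: "real ^ 'n \<Rightarrow> real" where "\<epsilon> y = \<rho> (norm y / 2) / 8" for y
  have "danzer_set (q ` D)"
    if D: "danzer_set D" and q: "\<And>y. y \<in> D \<Longrightarrow> norm (q y - y /\<^sub>R 16) < \<epsilon> y" for D q
    unfolding danzer_set_def
  proof (intro allI impI)
    fix K :: "(real ^ 'n) set"
    assume K: "convex K \<and> emeasure lebesgue K = 1"
    then obtain L where L: "L \<subseteq> K" "convex L" "bounded L"
      "measure lebesgue L \<ge> 1 / 2" "measure lebesgue L \<le> 1"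
      using bounded_part_of_half_volume by blast
    let ?v = "measure lebesgue L"
    have "L \<noteq> {}" using L(4) by auto
    with L(3) obtain p where p: "p \<in> L" "\<And>x. x \<in> L \<Longrightarrow> norm x \<le> 2 * norm p"
      using exists_almost_max_norm by blast
    obtain c where c: "\<And>R. L \<subseteq> cball 0 R \<Longrightarrow> ball c (\<rho> R) \<subseteq> L"
      using ball[OF L(2-4)] by blast
    have "L \<subseteq> cball 0 (2 * norm p)" using p by auto
    then have cL: "c \<in> L" using c \<rho> by (meson centre_in_ball subsetD)
    \<comment> \<open>Scaling by \<open>\<sigma>\<close> restores volume 1.\<close>
    define \<sigma> where "\<sigma> = root CARD('n) (1 / ?v)"
    have \<sigma>0: "\<sigma> > 0" using L(4) by (simp add: \<sigma>_def)
    have \<sigma>: "\<sigma> ^ CARD('n) * ?v = 1"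
      using L(4) by (simp add: \<sigma>_def real_root_pow_pos2)
    have \<sigma>2: "\<sigma> \<le> 2"
    proof -
      have "1 / ?v \<le> 2 ^ 1" using L(4) by (simp add: field_simps)
      also have "\<dots> \<le> (2::real) ^ CARD('n)" by (intro power_increasing) (auto simp: Suc_le_eq)
      finally have "\<sigma> ^ CARD('n) \<le> 2 ^ CARD('n)"
        using L(4) by (simp add: \<sigma>_def real_root_pow_pos2)
      then show ?thesis by (simp add: power_mono_iff \<sigma>0 less_imp_le)
    qed
    \<comment> \<open>The coefficients \<open>\<sigma>\<close>, \<open>14 - \<sigma>\<close> and 2
      add up to 16, so dividing a point of \<open>?L'\<close> by 16 gives a convex combination of
      \<open>x\<close>, \<open>p\<close> and \<open>c\<close>.\<close>
    let ?h = "(14 - \<sigma>) *\<^sub>R p + 2 *\<^sub>R c"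
    let ?L' = "(\<lambda>x. \<sigma> *\<^sub>R x + ?h) ` L"
    have "L \<in> lmeasurable" using L by (simp add: measurable_convex)
    then have "emeasure lebesgue ?L' = ennreal (\<sigma> ^ CARD('n) * ?v)"
      using \<sigma>0 by (simp add: emeasure_lebesgue_affine emeasure_eq_measure2 ennreal_mult ennreal_power)
    then have "emeasure lebesgue ?L' = 1" using \<sigma> by simp
    moreover have "?L' = (\<lambda>x. ?h + x) ` ((\<lambda>x. \<sigma> *\<^sub>R x) ` L)"
      by (simp add: image_image add.commute)
    then have "convex ?L'"
      using L(2) by (simp only: convex_translation convex_scaling)
    ultimately have "D \<inter> ?L' \<noteq> {}" using D unfolding danzer_set_def by blast
    then obtain x where x: "x \<in> L" and yD: "\<sigma> *\<^sub>R x + ?h \<in> D" by blast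
    define y where "y = \<sigma> *\<^sub>R x + ?h"
    \<comment> \<open>The term in \<open>p\<close> dominates: \<open>x\<close> and \<open>c\<close>
      have norm at most \<open>2 * norm p\<close>, and
      \<open>(14 - \<sigma>) - 2 * \<sigma> - 4 \<ge> 4\<close> since
      \<open>\<sigma> \<le> 2\<close>. Hence \<open>norm y\<close>, known to the perturbation,
      controls the size of \<open>L\<close>.\<close>
    have "4 * norm p \<le> norm y"
    proof -
      have "(14 - \<sigma>) *\<^sub>R p = y - \<sigma> *\<^sub>R x - 2 *\<^sub>R c" by (simp add: y_def)
      then have "norm ((14 - \<sigma>) *\<^sub>R p) \<le> norm y + norm (\<sigma> *\<^sub>R x) + norm (2 *\<^sub>R c)"
        using norm_triangle_ineq4[of "y - \<sigma> *\<^sub>R x" "2 *\<^sub>R c"] norm_triangle_ineq4[of y "\<sigma> *\<^sub>R x"]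
        by simp
      then have "(14 - \<sigma>) * norm p \<le> norm y + \<sigma> * norm x + 2 * norm c"
        using \<sigma>0 \<sigma>2 by simp
      moreover have "\<sigma> * norm x \<le> \<sigma> * (2 * norm p)" using p(2)[OF x] \<sigma>0 by simp
      moreover have "\<sigma> * norm p \<le> 2 * norm p" using \<sigma>2 by (simp add: mult_right_mono)
      ultimately show ?thesis using p(2)[OF cL] by (simp add: algebra_simps)
    qed
    then have "L \<subseteq> cball 0 (norm y / 2)" using p(2) by fastforce
    then have bL: "ball c (\<rho> (norm y / 2)) \<subseteq> L" by (rule c)
    define e where "e = q y - y /\<^sub>R 16"
    have "norm e < \<rho> (norm y / 2) / 8" using q[of y] yD by (simp add: e_def \<epsilon>_def y_def)
    \<comment> \<open>The whole error \<open>e\<close> is absorbed by moving \<open>c\<close>: with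
      weight 1/8, a shift of \<open>c\<close> by \<open>8 *\<^sub>R e\<close> moves the combination
      by \<open>e\<close>.\<close>
    then have "c + 8 *\<^sub>R e \<in> L" using bL by (auto simp: dist_norm)
    then have "convex hull {x, p, c + 8 *\<^sub>R e} \<subseteq> L"
      using L(2) x p(1) by (intro hull_minimal) auto
    moreover have "(\<sigma> / 16) *\<^sub>R x + ((14 - \<sigma>) / 16) *\<^sub>R p + (1 / 8) *\<^sub>R (c + 8 *\<^sub>R e)
        \<in> convex hull {x, p, c + 8 *\<^sub>R e}"
      unfolding convex_hull_3 mem_Collect_eq
      by (rule exI[of _ "\<sigma> / 16"], rule exI[of _ "(14 - \<sigma>) / 16"], rule exI[of _ "1 / 8"])
        (use \<sigma>0 \<sigma>2 in \<open>simp add: diff_divide_distrib\<close>)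
    moreover have "(\<sigma> / 16) *\<^sub>R x + ((14 - \<sigma>) / 16) *\<^sub>R p + (1 / 8) *\<^sub>R (c + 8 *\<^sub>R e) = q y"
      by (simp add: e_def y_def scaleR_add_right)
    ultimately have "q y \<in> L" by auto
    then show "q ` D \<inter> K \<noteq> {}" using yD L(1) by (auto simp: y_def)
  qed
  moreover have "\<epsilon> y > 0" for y using \<rho> by (simp add: \<epsilon>_def)
  ultimately show thesis using that by blast
qed

section \<open>Rational approximation and growth\<close>

lemma rational_points_dense:
  fixes x :: "real ^ 'n"
  assumes "e > 0"
  obtains r where "r \<in> rational_points" "norm (r - x) < e"
proof -
  have "x \<in> closure (\<Union>f \<in> Basis \<rightarrow> \<rat>. { \<Sum>i :: real ^ 'n \<in> Basis. f i *\<^sub>R i })"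
    by (simp add: closure_rational_coordinates)
  then obtain f where f: "f \<in> Basis \<rightarrow> \<rat>" "dist (\<Sum>i :: real ^ 'n \<in> Basis. f i *\<^sub>R i) x < e"
    using assms by (auto simp: closure_approachable)
  have "(\<Sum>i :: real ^ 'n \<in> Basis. f i *\<^sub>R i) $ k \<in> \<rat>" for k
  proof -
    have "axis k 1 \<in> (Basis :: (real ^ 'n) set)" by (simp add: axis_in_Basis_iff)
    then have "(\<Sum>i :: real ^ 'n \<in> Basis. f i *\<^sub>R i) \<bullet> axis k 1 = f (axis k 1)"
      by (simp add: inner_sum_left_Basis)
    then show ?thesis
      using f(1) \<open>axis k 1 \<in> Basis\<close> by (auto simp: cart_eq_inner_axis)
  qed
  with f(2) show thesis by (intro that) (auto simp: rational_points_def dist_norm)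
qed

text \<open>Preimages of points in the ball of radius \<open>T\<close> lie in the ball of radius
  \<open>16 * (T + 1)\<close>, and \<open>q\<close> cannot increase cardinality. Polynomial growth
  absorbs the change of radius.\<close>

lemma has_growth_image:
  fixes D :: "(real ^ 'n) set"
  assumes D: "has_growth D g" and g: "polynomial_growth g"
    and q: "\<And>y. y \<in> D \<Longrightarrow> norm y \<le> 16 * (norm (q y) + 1)"
  shows "has_growth (q ` D) g"
proof -
  have fin: "finite (D \<inter> ball 0 T)" for T using D by (simp add: has_growth_def)
  \<comment> \<open>This bound serves finiteness for every \<open>T\<close>; the simpler radius
    \<open>32 * T\<close> contains it only once \<open>T \<ge> 1\<close>.\<close>
  have sub: "q ` D \<inter> ball 0 T \<subseteq> q ` (D \<inter> ball 0 (16 * (T + 1)))" for T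
    using q by fastforce
  have "card (q ` D \<inter> ball 0 T) \<le> card (D \<inter> ball 0 (32 * T))" if "T \<ge> 1" for T
  proof -
    have "q ` D \<inter> ball 0 T \<subseteq> q ` (D \<inter> ball 0 (32 * T))" using sub[of T] that by fastforce
    then show ?thesis using fin by (meson card_image_le card_mono finite_imageI order_trans)
  qed
  then have "(\<lambda>T. real (card (q ` D \<inter> ball 0 T))) \<in> O(\<lambda>T. real (card (D \<inter> ball 0 (32 * T))))"
    by (intro bigoI[of _ 1] eventually_mono[OF eventually_ge_at_top[of 1]]) auto
  also have "(\<lambda>T. real (card (D \<inter> ball 0 (32 * T)))) \<in> O(\<lambda>T. g (32 * T))"
  proof (rule landau_o.big.compose)
    show "(\<lambda>T. real (card (D \<inter> ball 0 T))) \<in> O(g)" using D by (simp add: has_growth_def)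
    show "filterlim (\<lambda>T::real. 32 * T) at_top at_top"
      by (rule filterlim_tendsto_pos_mult_at_top[OF tendsto_const _ filterlim_ident]) simp
  qed
  also have "(\<lambda>T. g (32 * T)) \<in> O(g)" using g by (simp add: polynomial_growth_def)
  finally show ?thesis
    using sub fin unfolding has_growth_def by (meson finite_imageI finite_subset)
qed

theorem corollary1p5:
  fixes g :: "real \<Rightarrow> real"
  assumes "\<And>x. 0 < x \<Longrightarrow> 0 < g x"
    and "polynomial_growth g"
    and "\<exists>D :: (real ^ 'n) set. danzer_set D \<and> has_growth D g"
  shows "\<exists>D' :: (real ^ 'n) set. D' \<subseteq> rational_points \<and> danzer_set D' \<and> has_growth D' g"
proof -
  obtain D :: "(real ^ 'n) set" where D: "danzer_set D" "has_growth D g" using assms(3) by blast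
  obtain \<epsilon> :: "real ^ 'n \<Rightarrow> real" where \<epsilon>: "\<And>y. \<epsilon> y > 0"
    and perturb: "\<And>D q. \<lbrakk>danzer_set D; \<And>y. y \<in> D \<Longrightarrow> norm (q y - y /\<^sub>R 16) < \<epsilon> y\<rbrakk> \<Longrightarrow> danzer_set (q ` D)"
    using danzer_set_perturb by blast
  \<comment> \<open>The bound \<open>\<epsilon> y\<close> preserves the Danzer property, while the
    bound 1 keeps \<open>norm y\<close> comparable to \<open>norm (q y)\<close> for the growth
    estimate.\<close>
  have "\<exists>r. r \<in> rational_points \<and> norm (r - y /\<^sub>R 16) < min 1 (\<epsilon> y)" for y
    using rational_points_dense[of "min 1 (\<epsilon> y)"] \<epsilon> by (metis min_less_iff_conj zero_less_one)
  then obtain q where q: "\<And>y. q y \<in> rational_points" "\<And>y. norm (q y - y /\<^sub>R 16) < min 1 (\<epsilon> y)"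
    by metis
  have "danzer_set (q ` D)" using q(2) by (intro perturb[OF D(1)]) simp
  moreover have "has_growth (q ` D) g"
  proof (rule has_growth_image[OF D(2) assms(2)])
    fix y
    have "norm (y /\<^sub>R 16) \<le> norm (q y) + norm (q y - y /\<^sub>R 16)"
      by (metis norm_minus_commute norm_triangle_sub)
    then show "norm y \<le> 16 * (norm (q y) + 1)" using q(2)[of y] by simp
  qed
  moreover have "q ` D \<subseteq> rational_points" using q(1) by auto
  ultimately show ?thesis by blast
qed

end
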